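(* Consider Misère Connect $k$ on a board of height $h=1$ and finite width $w\ge 1$, with $k\ge 3$. Either player can force a draw by playing the two-rule strategy (take-other and rightmost): if P1 (playing X) uses the two-rule strategy then the game ends in a draw regardless of P2's moves, and if P2 (playing O) uses the two-rule strategy then the game ends in a draw regardless of P1's moves.
   Context: Misère Connect $k$ with height $1$ is played on a strip of $w$ cells in a row. Player 1 (P1, pieces X) and Player 2 (P2, pieces O) alternate turns, P1 first, each placing one of their own pieces in any empty cell. The first player to have $k$ of their pieces in $k$ consecutive cells loses. If the board fills without this happening, the game is a draw. The cells are grouped from left to right into consecutive pairs: cells $1,2$ form a pair, cells $3,4$ form a pair, and so on; if $w$ is odd, the rightmost cell is unpaired. The two-rule strategy for a player is, on each turn: 1. Take-other: if the opponent has taken one half of a pair (and the other half is empty), take the other half of that pair. 2. Rightmost: if no take-other move is available, play the rightmost empty cell. *)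

theory Defs
  imports Main
begin

text \<open>P1 plays the pieces X and moves first, P2 plays the pieces O.\<close>

datatype player = P1 | P2

fun opponent :: "player \<Rightarrow> player" where
  "opponent P1 = P2"
| "opponent P2 = P1"

text \<open>The cells of a strip of width \<open>w\<close> are \<open>1, \<dots>, w\<close>, from left to right.\<close>

type_synonym board = "nat \<rightharpoonup> player"

definition empty_cells :: "nat \<Rightarrow> board \<Rightarrow> nat set" where
  "empty_cells w b = {c \<in> {1..w}. b c = None}"

definition has_line :: "nat \<Rightarrow> nat \<Rightarrow> board \<Rightarrow> player \<Rightarrow> bool" where
  "has_line k w b p \<longleftrightarrow> (\<exists>s. {s..<s + k} \<subseteq> {1..w} \<and> (\<forall>c\<in>{s..<s + k}. b c = Some p))"

definition game_over :: "nat \<Rightarrow> nat \<Rightarrow> board \<Rightarrow> bool" where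
  "game_over k w b \<longleftrightarrow> (\<exists>p. has_line k w b p) \<or> empty_cells w b = {}"

definition drawn :: "nat \<Rightarrow> nat \<Rightarrow> board \<Rightarrow> bool" where
  "drawn k w b \<longleftrightarrow> (\<nexists>p. has_line k w b p) \<and> empty_cells w b = {}"

text \<open>A play is recorded as the list of the cells taken, in chronological order; \<open>mover i\<close> is the
  player whose turn it is after \<open>i\<close> moves.\<close>

definition mover :: "nat \<Rightarrow> player" where
  "mover i = (if even i then P1 else P2)"

definition board_of :: "nat list \<Rightarrow> board" where
  "board_of ms = map_of (zip ms (map mover [0..<length ms]))"

inductive legal_play :: "nat \<Rightarrow> nat \<Rightarrow> nat list \<Rightarrow> bool" for k w where
  start: "legal_play k w []"
| move: "legal_play k w (ms @ [c])"
    if "legal_play k w ms" "\<not> game_over k w (board_of ms)" "c \<in> empty_cells w (board_of ms)"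

text \<open>A strategy maps a board to the set of the moves it permits, so that no assumption is made
  on how a player following it chooses if it permits several moves.\<close>

type_synonym strategy = "board \<Rightarrow> nat set"

definition follows :: "player \<Rightarrow> strategy \<Rightarrow> nat list \<Rightarrow> bool" where
  "follows p S ms \<longleftrightarrow> (\<forall>i<length ms. mover i = p \<longrightarrow> ms ! i \<in> S (board_of (take i ms)))"

text \<open>The first conjunct says that the player can always carry out the strategy: on each of their
  turns it permits some move, and only legal ones. Every play ends after at most \<open>w\<close> moves,
  so it is enough to consider the finished plays in the second conjunct.\<close>

definition forces_draw :: "nat \<Rightarrow> nat \<Rightarrow> player \<Rightarrow> strategy \<Rightarrow> bool" where
  "forces_draw k w p S \<longleftrightarrow>
     (\<forall>ms. legal_play k w ms \<and> follows p S ms \<and> \<not> game_over k w (board_of ms) \<and>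
        mover (length ms) = p \<longrightarrow>
        S (board_of ms) \<noteq> {} \<and> S (board_of ms) \<subseteq> empty_cells w (board_of ms)) \<and>
     (\<forall>ms. legal_play k w ms \<and> follows p S ms \<and> game_over k w (board_of ms) \<longrightarrow>
        drawn k w (board_of ms))"

text \<open>The pairs are \<open>{1, 2}, {3, 4}, \<dots>\<close>. If \<open>w\<close> is odd, the partner of \<open>w\<close> is off the board,
  that is, cell \<open>w\<close> is unpaired.\<close>

definition partner :: "nat \<Rightarrow> nat" where
  "partner c = (if odd c then c + 1 else c - 1)"

definition take_other :: "nat \<Rightarrow> player \<Rightarrow> strategy" where
  "take_other w p b =
     {c \<in> empty_cells w b. partner c \<in> {1..w} \<and> b (partner c) = Some (opponent p)}"

definition rightmost :: "nat \<Rightarrow> strategy" where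
  "rightmost w b = {c \<in> empty_cells w b. \<forall>d\<in>empty_cells w b. d \<le> c}"

definition two_rule :: "nat \<Rightarrow> player \<Rightarrow> strategy" where
  "two_rule w p b = (if take_other w p b \<noteq> {} then take_other w p b else rightmost w b)"

end

theory Submission
  imports Defs
begin

text \<open>
  Three consecutive cells contain a whole pair, because the partner of the middle one is one of its
  two neighbours. So it suffices that no pair is ever filled with two equal pieces
  (\<open>mixed_pairs\<close>): then nobody ever has a line, and the play can only end with a full board.

  Let \<open>p\<close> be the player of the two-rule strategy and \<open>q\<close> the other one. Taking the other half of a
  pair of \<open>q\<close> prevents \<open>q\<close> from completing that pair, and it makes the pair mixed. The danger is
  the second rule: the rightmost empty cell might complete a pair whose other half is \<open>p\<close>'s own.
  The strategy avoids this because empty cells without an empty partner, called loose below, are rare.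
  Such a cell is unpaired or the rest of a half-taken pair. When \<open>q\<close> is to move, there is at
  most one loose cell, and its partner is not occupied by \<open>q\<close>. If \<open>q\<close> takes the loose cell, none is
  left; otherwise \<open>q\<close> opens a new pair and \<open>p\<close> answers in that pair. Hence \<open>p\<close> uses the second rule
  only if no cell is loose (or the unpaired cell is the only loose one, as on the
  first move of P1). The rightmost empty cell is then in an empty pair or unpaired, and
  playing it leaves, once more, at most one loose cell.
\<close>

lemma opponent_neq [simp]: "opponent p \<noteq> p" "p \<noteq> opponent p"
  by (cases p; simp)+

lemma partner_partner [simp]: "partner (partner c) = c"
  by (auto simp: partner_def)

lemma partner_neq: "c \<ge> 1 \<Longrightarrow> partner c \<noteq> c"
  by (auto simp: partner_def)

lemma unpaired_is_last:
  assumes "c \<in> {1..w}" "partner c \<notin> {1..w}"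
  shows "c = w"
  using assms by (auto simp: partner_def split: if_splits elim!: evenE)

definition mixed_pairs :: "nat \<Rightarrow> board \<Rightarrow> bool" where
  "mixed_pairs w b \<longleftrightarrow>
     (\<forall>c\<in>{1..w}. partner c \<in> {1..w} \<longrightarrow> b c \<noteq> None \<longrightarrow> b (partner c) \<noteq> b c)"

lemma mixed_pairs_imp_no_line:
  assumes "mixed_pairs w b" "k \<ge> 3"
  shows "\<not> has_line k w b p"
proof
  assume "has_line k w b p"
  then obtain s where s: "{s..<s + k} \<subseteq> {1..w}" "\<forall>c\<in>{s..<s + k}. b c = Some p"
    unfolding has_line_def by blast
  have "Suc s \<in> {s..<s + k}" "partner (Suc s) \<in> {s..<s + k}"
    using assms(2) by (auto simp: partner_def)
  with s have "Suc s \<in> {1..w}" "partner (Suc s) \<in> {1..w}" "b (Suc s) = Some p"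
    "b (partner (Suc s)) = Some p"
    by blast+
  with assms(1) show False
    unfolding mixed_pairs_def by fastforce
qed

lemma mixed_pairs_update:
  assumes "mixed_pairs w b" "m \<in> empty_cells w b"
    and "partner m \<in> {1..w} \<Longrightarrow> b (partner m) \<noteq> Some r"
  shows "mixed_pairs w (b(m \<mapsto> r))"
  unfolding mixed_pairs_def
proof (intro ballI impI)
  fix c assume c: "c \<in> {1..w}" "partner c \<in> {1..w}" "(b(m \<mapsto> r)) c \<noteq> None"
  have "partner c \<noteq> c" using c(1) partner_neq by simp
  consider "c = m" | "c \<noteq> m" "partner c = m" | "c \<noteq> m" "partner c \<noteq> m" by blast
  then show "(b(m \<mapsto> r)) (partner c) \<noteq> (b(m \<mapsto> r)) c"
  proof cases
    case 1
    then show ?thesis using assms(3) c(2) \<open>partner c \<noteq> c\<close> by simp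
  next
    case 2
    then have "partner m = c" by auto
    then show ?thesis using 2 assms(3) c(1) by auto
  next
    case 3
    then show ?thesis using assms(1) c by (auto simp: mixed_pairs_def)
  qed
qed

definition loose :: "nat \<Rightarrow> board \<Rightarrow> nat set" where
  "loose w b = {c \<in> empty_cells w b. partner c \<notin> empty_cells w b}"

lemma take_other_subset_loose: "take_other w p b \<subseteq> loose w b"
  by (auto simp: take_other_def loose_def empty_cells_def)

lemma empty_cells_update: "empty_cells w (b(m \<mapsto> r)) = empty_cells w b - {m}"
  by (auto simp: empty_cells_def)

lemma loose_update:
  assumes "m \<in> empty_cells w b"
  shows "loose w (b(m \<mapsto> r)) = (loose w b - {m}) \<union> ({partner m} \<inter> empty_cells w b)"
proof -
  have "partner m \<noteq> m" using assms partner_neq by (simp add: empty_cells_def)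
  then show ?thesis
    using assms unfolding loose_def empty_cells_update by (auto simp: empty_cells_def)
qed

lemma take_other_update:
  assumes "m \<in> empty_cells w b"
  shows "take_other w p (b(m \<mapsto> r)) =
    (take_other w p b - {m}) \<union> (if r = opponent p then {partner m} \<inter> empty_cells w b else {})"
proof -
  have "partner m \<noteq> m" using assms partner_neq by (simp add: empty_cells_def)
  then show ?thesis
    using assms unfolding take_other_def empty_cells_update by (auto simp: empty_cells_def)
qed

text \<open>The invariant at the turns of the opponent of \<open>p\<close>.\<close>

definition settled :: "nat \<Rightarrow> player \<Rightarrow> board \<Rightarrow> bool" where
  "settled w p b \<longleftrightarrow> mixed_pairs w b \<and> take_other w p b = {} \<and>
     (\<forall>c\<in>loose w b. \<forall>d\<in>loose w b. c = d)"

text \<open>The invariant at the turns of \<open>p\<close>. The last clause makes the second rule safe: if there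
  is no pair to answer in, the rightmost empty cell does not complete a pair.\<close>

definition answerable :: "nat \<Rightarrow> player \<Rightarrow> board \<Rightarrow> bool" where
  "answerable w p b \<longleftrightarrow> mixed_pairs w b \<and>
     (\<forall>c\<in>take_other w p b. \<forall>d\<in>take_other w p b. c = d) \<and>
     (\<forall>c\<in>loose w b - take_other w p b. \<forall>d\<in>loose w b - take_other w p b. c = d) \<and>
     (take_other w p b = {} \<longrightarrow> (\<forall>c\<in>loose w b. partner c \<notin> {1..w}))"

lemma empty_board_invariants:
  "settled w p Map.empty" "answerable w p Map.empty"
proof -
  have "loose w Map.empty \<subseteq> {w}"
    using unpaired_is_last by (auto simp: loose_def empty_cells_def simp del: atLeastAtMost_iff)
  moreover have "take_other w p Map.empty = {}" "mixed_pairs w Map.empty"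
    by (auto simp: take_other_def mixed_pairs_def)
  moreover have "\<forall>c\<in>loose w Map.empty. partner c \<notin> {1..w}"
    by (auto simp: loose_def empty_cells_def)
  ultimately show "settled w p Map.empty" "answerable w p Map.empty"
    unfolding settled_def answerable_def by blast+
qed

text \<open>The opponent either takes the only loose cell, which leaves none, or opens a fresh pair,
  whose other half becomes the cell for the next answer.\<close>

lemma answerable_after_opponent_move:
  assumes "settled w p b" "m \<in> empty_cells w b"
  shows "answerable w p (b(m \<mapsto> opponent p))"
proof -
  have no_answer: "take_other w p b = {}"
    and one: "\<And>c d. c \<in> loose w b \<Longrightarrow> d \<in> loose w b \<Longrightarrow> c = d"
    and mixed: "mixed_pairs w b"
    using assms(1) unfolding settled_def by blast+
  have "mixed_pairs w (b(m \<mapsto> opponent p))"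
    using mixed_pairs_update[OF mixed assms(2)] no_answer assms(2)
    by (auto simp: take_other_def)
  moreover have "take_other w p (b(m \<mapsto> opponent p)) = {partner m} \<inter> empty_cells w b"
    using take_other_update[OF assms(2)] no_answer by simp
  moreover have "loose w (b(m \<mapsto> opponent p)) = (loose w b - {m}) \<union> ({partner m} \<inter> empty_cells w b)"
    using loose_update[OF assms(2)] .
  moreover have "loose w b - {m} = {}" if "{partner m} \<inter> empty_cells w b = {}"
  proof -
    have "m \<in> loose w b" using that assms(2) by (auto simp: loose_def)
    then show ?thesis using one by blast
  qed
  ultimately show ?thesis
    unfolding answerable_def using one by auto
qed

text \<open>An answer removes the loose cell that the opponent has just created. The second rule is
  applied either to the unpaired cell, which is then the only loose one, or to an untouched pair
  when no cell is loose.\<close>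

lemma settled_after_two_rule:
  assumes "answerable w p b" "m \<in> two_rule w p b"
  shows "settled w p (b(m \<mapsto> p))"
proof -
  have mixed: "mixed_pairs w b"
    and one_answer: "\<And>c d. c \<in> take_other w p b \<Longrightarrow> d \<in> take_other w p b \<Longrightarrow> c = d"
    and one_rest: "\<And>c d. c \<in> loose w b - take_other w p b \<Longrightarrow>
      d \<in> loose w b - take_other w p b \<Longrightarrow> c = d"
    and unpaired: "\<And>c. take_other w p b = {} \<Longrightarrow> c \<in> loose w b \<Longrightarrow> partner c \<notin> {1..w}"
    using assms(1) unfolding answerable_def by blast+
  have m: "m \<in> empty_cells w b"
    using assms(2) by (auto simp: two_rule_def take_other_def rightmost_def split: if_splits)
  note upd = loose_update[OF m, of p] take_other_update[OF m, of p p]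
  show ?thesis
  proof (cases "take_other w p b = {}")
    case False
    then have answer: "m \<in> take_other w p b" using assms(2) by (simp add: two_rule_def)
    then have "take_other w p b = {m}" using one_answer by blast
    moreover have taken: "b (partner m) = Some (opponent p)"
      using answer by (simp add: take_other_def)
    then have "partner m \<notin> empty_cells w b" by (simp add: empty_cells_def)
    moreover have "mixed_pairs w (b(m \<mapsto> p))"
      using mixed_pairs_update[OF mixed m] taken by simp
    ultimately show ?thesis
      using upd one_rest unfolding settled_def by auto
  next
    case True
    then have right: "\<And>d. d \<in> empty_cells w b \<Longrightarrow> d \<le> m"
      using assms(2) by (simp add: two_rule_def rightmost_def)
    \<comment> \<open>A loose cell is now the unpaired one; it lies at the right end, so the second rule takes it.\<close>
    have "c = m" if "c \<in> loose w b" for c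
    proof -
      have "c \<in> empty_cells w b" using that by (simp add: loose_def)
      moreover have "c = w"
        using unpaired_is_last unpaired[OF True that] calculation by (simp add: empty_cells_def)
      ultimately show ?thesis using right[of c] m by (simp add: empty_cells_def)
    qed
    moreover have "b (partner m) \<noteq> Some p" if "partner m \<in> {1..w}"
      using unpaired[OF True, of m] that m by (auto simp: loose_def empty_cells_def)
    then have "mixed_pairs w (b(m \<mapsto> p))"
      using mixed_pairs_update[OF mixed m] by blast
    ultimately show ?thesis
      using upd True unfolding settled_def by auto
  qed
qed

lemma board_of_snoc:
  assumes "c \<in> empty_cells w (board_of ms)"
  shows "board_of (ms @ [c]) = (board_of ms)(c \<mapsto> mover (length ms))"
proof -
  \<comment> \<open>In an association list the first entry wins, so a repeated cell would keep its old piece.\<close>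
  have "board_of (ms @ [c]) = [c \<mapsto> mover (length ms)] ++ board_of ms"
    by (simp add: board_of_def)
  then show ?thesis
    using assms by (auto simp: empty_cells_def fun_eq_iff map_add_def split: option.split)
qed

lemma follows_snoc:
  "follows p S (ms @ [c]) \<longleftrightarrow>
     follows p S ms \<and> (mover (length ms) = p \<longrightarrow> c \<in> S (board_of ms))"
  by (auto simp: follows_def nth_append less_Suc_eq)

lemma mover_Suc: "mover (Suc n) = opponent (mover n)"
  by (simp add: mover_def)

lemma two_rule_invariant:
  assumes "legal_play k w ms" "follows p (two_rule w p) ms"
  shows "if mover (length ms) = p then answerable w p (board_of ms)
    else settled w p (board_of ms)"
  using assms
proof (induction rule: legal_play.induct)
  case start
  have "board_of [] = Map.empty" by (simp add: board_of_def)
  then show ?case using empty_board_invariants by simp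
next
  case (move ms c)
  note board = board_of_snoc[OF move.hyps(3)]
  show ?case
  proof (cases "mover (length ms) = p")
    case True
    then have "settled w p (board_of (ms @ [c]))"
      using move settled_after_two_rule board by (simp add: follows_snoc)
    then show ?thesis using True by (simp add: mover_Suc)
  next
    case False
    then have "mover (length ms) = opponent p" "opponent (mover (length ms)) = p"
      by (cases p; cases "mover (length ms)"; simp)+
    moreover from this have "answerable w p (board_of (ms @ [c]))"
      using False move answerable_after_opponent_move board by (simp add: follows_snoc)
    ultimately show ?thesis by (simp add: mover_Suc)
  qed
qed

lemma two_rule_forces_draw:
  assumes "k \<ge> 3"
  shows "forces_draw k w p (two_rule w p)"
  unfolding forces_draw_def
proof (intro conjI allI impI; elim conjE)
  fix ms assume "\<not> game_over k w (board_of ms)"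
  then have ne: "empty_cells w (board_of ms) \<noteq> {}" by (simp add: game_over_def)
  have fin: "finite (empty_cells w (board_of ms))" by (simp add: empty_cells_def)
  have "Max (empty_cells w (board_of ms)) \<in> rightmost w (board_of ms)"
    using Max_in[OF fin ne] Max_ge[OF fin] by (simp add: rightmost_def)
  then show "two_rule w p (board_of ms) \<noteq> {}" by (auto simp: two_rule_def)
  show "two_rule w p (board_of ms) \<subseteq> empty_cells w (board_of ms)"
    by (auto simp: two_rule_def take_other_def rightmost_def)
next
  fix ms
  assume "legal_play k w ms" "follows p (two_rule w p) ms" and over: "game_over k w (board_of ms)"
  then have "mixed_pairs w (board_of ms)"
    using two_rule_invariant by (fastforce simp: answerable_def settled_def split: if_splits)
  then have "\<nexists>p. has_line k w (board_of ms) p"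
    using mixed_pairs_imp_no_line assms by blast
  then show "drawn k w (board_of ms)"
    using over by (simp add: drawn_def game_over_def)
qed

theorem theorem3:
  fixes k w :: nat
  assumes "k \<ge> 3" and "w \<ge> 1"
  shows "forces_draw k w P1 (two_rule w P1) \<and> forces_draw k w P2 (two_rule w P2)"
  using two_rule_forces_draw[OF assms(1)] by blast

end
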